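(* Let $f = f_{0}+\sum_{j=1}^n f_{\alpha(j)} x^{\alpha(j)} +\sum_{\alpha \in \Delta(f)} f_\alpha x^\alpha\in\mathbb{R}[x_1,\dots,x_n]$ be an ST-polynomial in standard form, and let $r\in\mathbb{R}$. Suppose that for every $(\alpha,j) \in \Delta(f) \times \{1,\ldots,n\}$ there exists an $a_{\alpha,j} \geq 0$ such that: (0) if $\lambda_j^{(\alpha)}>0$, then $a_{\alpha,j} > 0$; (1) $|f_\alpha| \leq \prod_{j\in \mathrm{nz}(\alpha),\, j\geq 1} \left(\frac{a_{\alpha,j}}{\lambda_j^{(\alpha)}}\right)^{\lambda_j^{(\alpha)}}$ for every $\alpha \in \Delta(f)$ with $\lambda_0^{(\alpha)}=0$; (2) $f_{\alpha(j)} \geq \sum_{\alpha\in \Delta(f)} a_{\alpha,j}$ for all $j = 1,\ldots,n$; (3) $f_0-r \geq \sum_{\alpha \in \Delta(f),\, 0 \in \mathrm{nz}(\alpha)} \lambda_0^{(\alpha)} |f_\alpha|^{1/\lambda_0^{(\alpha)}} \prod_{j\in \mathrm{nz}(\alpha),\, j\geq 1} \left(\frac{\lambda_j^{(\alpha)}}{a_{\alpha,j}}\right)^{\lambda_j^{(\alpha)}/\lambda_0^{(\alpha)}}$. Then $f-r$ is a sum of $|\Delta(f)|$ nonnegative circuit polynomials whose Newton polytopes are faces of $\mathrm{conv}(\{0\} \cup V(f))$.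
   Context: Notation: $\mathbb{N}$ contains $0$; $x^\alpha = x_1^{\alpha_1}\cdots x_n^{\alpha_n}$; $\mathrm{New}(f)$ is the Newton polytope (convex hull of the exponents with nonzero coefficient) and $V(f)$ is the vertex set of $\mathrm{New}(f)$. A polynomial is nonnegative if it is $\geq 0$ on all of $\mathbb{R}^n$. An ST-polynomial in standard form is a polynomial $f = f_{\alpha(0)}+\sum_{j=1}^n f_{\alpha(j)} x^{\alpha(j)} +\sum_{\alpha \in \Delta} f_\alpha x^\alpha$ such that: (ST1) $\alpha(0)=0$ and $\alpha(1),\ldots,\alpha(n)$ form a set $V$ of affinely independent points in $(2\mathbb{N})^n$. (ST2) $\Delta$ is the set of exponents $\alpha$ in $f$ not defining monomial squares, i.e. $\alpha\in\Delta$ iff $f_\alpha<0$, or $\alpha\notin(2\mathbb{N})^n$ and $f_\alpha>0$. (ST3) $\Delta\subseteq \mathrm{conv}(V)$; equivalently every $\alpha\in\Delta$ is uniquely written $\alpha=\sum_{j=0}^n\lambda_j^{(\alpha)}\alpha(j)$ with $\lambda_j^{(\alpha)}\ge 0$, $\sum_{j=0}^n\lambda_j^{(\alpha)}=1$. (ST4) $f_0 = f_{\alpha(0)},f_{\alpha(1)},\ldots,f_{\alpha(n)}$ are nonnegative, and if $f_{\alpha(j)}=0$ then $\lambda_j^{(\alpha)}=0$ for all $\alpha\in\Delta$. One writes $\Delta(f)=\Delta$ and $\mathrm{nz}(\alpha)=\{j\in\{0,\ldots,n\}:\lambda_j^{(\alpha)}\neq 0\}$. A circuit polynomial is an ST-polynomial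 whose set $\Delta$ is empty or a singleton.
   Formalization: The number of summands is max(1, |Δ(f)|) instead of |Δ(f)|: for Δ(f) empty the claim fails as written (f = 1 + x², r = 0 is not an empty sum), and there f − r is shown to be a single nonnegative circuit polynomial. *)

theory Defs
  imports "HOL-Analysis.Analysis" "HOL-Library.Poly_Mapping"
begin

text \<open>
  Polynomials in \<open>n = CARD('n)\<close> variables are finitely supported maps from exponent
  vectors to coefficients: \<open>Poly_Mapping.lookup f \<alpha>\<close> is the coefficient of \<open>x\<^sup>\<alpha>\<close>,
  \<open>Poly_Mapping.keys f\<close> the set of exponents with nonzero coefficient, and
  \<open>Poly_Mapping.single \<alpha> c\<close> the monomial \<open>c x\<^sup>\<alpha>\<close>.
\<close>

type_synonym 'n rpoly = "(nat ^ 'n) \<Rightarrow>\<^sub>0 real"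

abbreviation coeff_of :: "'n::finite rpoly \<Rightarrow> nat ^ 'n \<Rightarrow> real" where
  "coeff_of f \<alpha> \<equiv> Poly_Mapping.lookup f \<alpha>"

definition monom_eval :: "real ^ 'n \<Rightarrow> nat ^ 'n::finite \<Rightarrow> real" where
  "monom_eval x \<alpha> = (\<Prod>i\<in>UNIV. (x $ i) ^ (\<alpha> $ i))"

definition poly_eval :: "'n::finite rpoly \<Rightarrow> real ^ 'n \<Rightarrow> real" where
  "poly_eval f x = (\<Sum>\<alpha>\<in>Poly_Mapping.keys f. coeff_of f \<alpha> * monom_eval x \<alpha>)"

definition nonneg_poly :: "'n::finite rpoly \<Rightarrow> bool" where
  "nonneg_poly f \<longleftrightarrow> (\<forall>x. poly_eval f x \<ge> 0)"

definition point :: "nat ^ 'n::finite \<Rightarrow> real ^ 'n" where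
  "point \<alpha> = (\<chi> i. real (\<alpha> $ i))"

definition New :: "'n::finite rpoly \<Rightarrow> (real ^ 'n) set" where
  "New f = convex hull (point ` Poly_Mapping.keys f)"

definition vertices :: "'n::finite rpoly \<Rightarrow> (real ^ 'n) set" where
  "vertices f = {v. v extreme_point_of New f}"

definition even_exponent :: "nat ^ 'n::finite \<Rightarrow> bool" where
  "even_exponent \<alpha> \<longleftrightarrow> (\<forall>i. even (\<alpha> $ i))"

definition Delta :: "'n::finite rpoly \<Rightarrow> (nat ^ 'n) set" where
  "Delta f = {\<alpha> \<in> Poly_Mapping.keys f.
     coeff_of f \<alpha> < 0 \<or> (\<not> even_exponent \<alpha> \<and> coeff_of f \<alpha> > 0)}"

text \<open>
  A family \<open>A 0, \<dots>, A n\<close> of exponents is a function on \<^typ>\<open>nat\<close> of which only the values at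
  \<open>j \<le> CARD('n)\<close> matter. \<open>bary A \<alpha> j\<close> is the coefficient \<open>\<lambda>\<^sub>j\<close> of \<open>A j\<close> in the convex
  representation of \<open>\<alpha>\<close>; values at \<open>j > CARD('n)\<close> are set to \<open>0\<close> only to make the function
  \<open>bary A \<alpha>\<close> unique. It is meaningful only if \<open>A 0, \<dots>, A n\<close> are affinely independent and
  \<open>\<alpha>\<close> is in their convex hull, see \<open>bary_unique\<close> below.
\<close>

definition is_bary :: "(nat \<Rightarrow> nat ^ 'n::finite) \<Rightarrow> nat ^ 'n \<Rightarrow> (nat \<Rightarrow> real) \<Rightarrow> bool" where
  "is_bary A \<alpha> l \<longleftrightarrow>
     (\<forall>j\<le>CARD('n). l j \<ge> 0) \<and> (\<forall>j>CARD('n). l j = 0) \<and>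
     (\<Sum>j=0..CARD('n). l j) = 1 \<and>
     point \<alpha> = (\<Sum>j=0..CARD('n). l j *\<^sub>R point (A j))"

definition bary :: "(nat \<Rightarrow> nat ^ 'n::finite) \<Rightarrow> nat ^ 'n \<Rightarrow> nat \<Rightarrow> real" where
  "bary A \<alpha> = (THE l. is_bary A \<alpha> l)"

definition nz :: "(nat \<Rightarrow> nat ^ 'n::finite) \<Rightarrow> nat ^ 'n \<Rightarrow> nat set" where
  "nz A \<alpha> = {j \<in> {0..CARD('n)}. bary A \<alpha> j \<noteq> 0}"

definition aff_indep_family :: "(nat \<Rightarrow> nat ^ 'n::finite) \<Rightarrow> bool" where
  "aff_indep_family A \<longleftrightarrow>
     inj_on A {0..CARD('n)} \<and> \<not> affine_dependent (point ` A ` {0..CARD('n)})"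

text \<open>\<open>ST_poly A f\<close>: \<open>f\<close> is an ST-polynomial in standard form with respect to \<open>A 0, \<dots>, A n\<close>.
  The coefficients at the \<open>A j\<close> may vanish.\<close>

definition ST_poly :: "(nat \<Rightarrow> nat ^ 'n::finite) \<Rightarrow> 'n rpoly \<Rightarrow> bool" where
  "ST_poly A f \<longleftrightarrow>
     f = Poly_Mapping.single 0 (coeff_of f 0)
       + (\<Sum>j=1..CARD('n). Poly_Mapping.single (A j) (coeff_of f (A j)))
       + (\<Sum>\<alpha>\<in>Delta f. Poly_Mapping.single \<alpha> (coeff_of f \<alpha>)) \<and>
     A 0 = 0 \<and> aff_indep_family A \<and> (\<forall>j\<le>CARD('n). even_exponent (A j)) \<and>
     point ` Delta f \<subseteq> convex hull (point ` A ` {0..CARD('n)}) \<and>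
     (\<forall>j\<le>CARD('n). coeff_of f (A j) \<ge> 0 \<and>
        (coeff_of f (A j) = 0 \<longrightarrow> (\<forall>\<alpha>\<in>Delta f. bary A \<alpha> j = 0)))"

definition circuit_poly :: "'n::finite rpoly \<Rightarrow> bool" where
  "circuit_poly f \<longleftrightarrow> (\<exists>A. ST_poly A f) \<and> (Delta f = {} \<or> (\<exists>\<alpha>. Delta f = {\<alpha>}))"

lemma inj_point: "inj point"
  by (auto simp: inj_def point_def vec_eq_iff)

lemma bary_unique:
  fixes A :: "nat \<Rightarrow> nat ^ 'n::finite"
  assumes "aff_indep_family A" and "point \<alpha> \<in> convex hull (point ` A ` {0..CARD('n)})"
  shows "\<exists>!l. is_bary A \<alpha> l"
proof -
  let ?I = "{0..CARD('n)}"
  let ?p = "\<lambda>j. point (A j)"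
  have inj: "inj_on ?p ?I"
    using assms(1) inj_point unfolding aff_indep_family_def inj_on_def by blast
  have im: "point ` A ` ?I = ?p ` ?I" by auto
  obtain u where u: "\<forall>v\<in>?p ` ?I. u v \<ge> 0" "sum u (?p ` ?I) = 1"
      "(\<Sum>v\<in>?p ` ?I. u v *\<^sub>R v) = point \<alpha>"
    using assms(2) unfolding im convex_hull_finite[OF finite_imageI[OF finite_atLeastAtMost]] by auto
  have ex: "is_bary A \<alpha> (\<lambda>j. if j \<le> CARD('n) then u (?p j) else 0)"
    using u unfolding is_bary_def by (auto simp: sum.reindex[OF inj] intro!: sum.cong)
  have "l = l'" if l: "is_bary A \<alpha> l" "is_bary A \<alpha> l'" for l l'
  proof (rule ccontr)
    assume "l \<noteq> l'"
    then obtain j where j: "l j \<noteq> l' j" by auto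
    with l have jI: "j \<in> ?I" unfolding is_bary_def by (metis atLeastAtMost_iff leI le0)
    define U where "U v = l (inv_into ?I ?p v) - l' (inv_into ?I ?p v)" for v
    have U: "U (?p i) = l i - l' i" if "i \<in> ?I" for i
      unfolding U_def inv_into_f_f[OF inj that] ..
    have "sum U (?p ` ?I) = (\<Sum>i\<in>?I. l i - l' i)"
      unfolding sum.reindex[OF inj] o_def by (rule sum.cong) (auto simp: U)
    also have "\<dots> = 0" using l by (simp add: is_bary_def sum_subtractf)
    finally have s: "sum U (?p ` ?I) = 0" .
    have "(\<Sum>v\<in>?p ` ?I. U v *\<^sub>R v) = (\<Sum>i\<in>?I. l i *\<^sub>R ?p i - l' i *\<^sub>R ?p i)"
      unfolding sum.reindex[OF inj] o_def
      by (rule sum.cong) (auto simp: U scaleR_diff_left)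
    also have "\<dots> = 0" using l by (auto simp: is_bary_def sum_subtractf)
    finally have t: "(\<Sum>v\<in>?p ` ?I. U v *\<^sub>R v) = 0" .
    have "U (?p j) \<noteq> 0" using j jI U by auto
    with s t jI have "affine_dependent (?p ` ?I)"
      by (subst affine_dependent_explicit_finite) blast+
    with assms(1) im show False by (simp add: aff_indep_family_def)
  qed
  with ex show ?thesis by blast
qed

end

theory Submission
  imports Defs
begin

text \<open>
  A single exponent \<open>\<alpha>\<close> in the simplex with vertices \<open>A 0, \<dots>, A n\<close> is the weighted mean of the
  vertices with weights \<open>\<lambda>\<^sub>j = bary A \<alpha> j\<close>, so \<open>\<bar>x\<^sup>\<alpha>\<bar>\<close> is the weighted geometric mean of the monomials
  \<open>x\<^bsup>A j\<^esup>\<close>, which are nonnegative because the \<open>A j\<close> are even. The inequality of the weighted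
  arithmetic and geometric means turns this into a sufficient condition for nonnegativity of the
  circuit polynomial \<open>\<Sum>\<^sub>j b\<^sub>j x\<^bsup>A j\<^esup> + c x\<^sup>\<alpha>\<close>, namely that \<open>\<bar>c\<bar>\<close> is at most its circuit number
  \<open>\<Prod>\<^sub>j (b\<^sub>j / \<lambda>\<^sub>j) powr \<lambda>\<^sub>j\<close> (lemma \<open>circuit_number_bound\<close>).

  The numbers \<open>a\<^sub>\<alpha>\<^sub>,\<^sub>j\<close> say how much of the coefficient at \<open>A j\<close>, for \<open>j \<ge> 1\<close>, is reserved for \<open>\<alpha>\<close>.
  If \<open>\<lambda>\<^sub>0 = 0\<close>, the bound on \<open>\<bar>f\<^sub>\<alpha>\<bar>\<close> in the hypotheses is the circuit number condition itself. If
  \<open>\<lambda>\<^sub>0 > 0\<close>, some constant term has to be reserved too, and the summand of \<open>\<alpha>\<close> in the bound on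
  \<open>f\<^sub>0 - r\<close> is exactly the constant that makes the circuit number equal to \<open>\<bar>f\<^sub>\<alpha>\<bar>\<close>
  (lemma \<open>circuit_number_with_constant\<close>). The remaining hypotheses say that the reserved amounts do
  not exceed what \<open>f - r\<close> offers at each vertex; the surplus is given to one of the exponents
  (lemma \<open>distribute_surplus\<close>), which only raises its circuit number. This splits \<open>f - r\<close> into one
  nonnegative circuit polynomial for each \<open>\<alpha>\<close>, all of them over the same simplex.

  Inner exponents lie in the hull of those vertices that carry a positive coefficient, so the Newton
  polytope of each summand, and that of \<open>f\<close>, is spanned by a subset of the affinely independent
  points \<open>A j\<close>. Faces of a simplex are exactly the hulls of subsets of its vertices. Therefore the
  statement on Newton polytopes reduces to the inclusion of vertex sets: a vertex used by a summand
  other than the origin has a positive coefficient in \<open>f\<close>.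
\<close>

section \<open>Weighted arithmetic and geometric means\<close>

text \<open>
  Convexity of the exponential function at the points \<open>ln (x i)\<close>; this needs all \<open>x i\<close> to be
  positive, and otherwise the left-hand side vanishes.
\<close>

lemma weighted_geometric_le_arithmetic_mean:
  fixes w x :: "'a \<Rightarrow> real"
  assumes "finite S" and w: "\<And>i. i \<in> S \<Longrightarrow> w i > 0" and sum1: "sum w S = 1"
    and x: "\<And>i. i \<in> S \<Longrightarrow> x i \<ge> 0"
  shows "(\<Prod>i\<in>S. x i powr w i) \<le> (\<Sum>i\<in>S. w i * x i)"
proof (cases "\<exists>i\<in>S. x i = 0")
  case True
  then have "(\<Prod>i\<in>S. x i powr w i) = 0"
    using \<open>finite S\<close> by (auto simp: prod_zero_iff)
  also have "\<dots> \<le> (\<Sum>i\<in>S. w i * x i)"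
    using w x by (intro sum_nonneg mult_nonneg_nonneg) (auto intro: less_imp_le)
  finally show ?thesis .
next
  case False
  with x have pos: "x i > 0" if "i \<in> S" for i
    using that by (metis less_eq_real_def)
  have "S \<noteq> {}" using sum1 by auto
  have "(\<Prod>i\<in>S. x i powr w i) = exp (\<Sum>i\<in>S. w i *\<^sub>R ln (x i))"
    using pos \<open>finite S\<close> by (force simp: exp_sum powr_def intro: prod.cong)
  also have "\<dots> \<le> (\<Sum>i\<in>S. w i * exp (ln (x i)))"
    using w sum1 \<open>S \<noteq> {}\<close> \<open>finite S\<close>
    by (intro convex_on_sum[OF _ _ exp_convex]) (auto intro: less_imp_le)
  also have "\<dots> = (\<Sum>i\<in>S. w i * x i)"
    using pos by (auto intro: sum.cong)
  finally show ?thesis .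
qed

text \<open>
  One coordinate of the identity for monomials below. At \<open>t = 0\<close> both sides follow the same
  dichotomy: since the weights are positive, \<open>m = 0\<close> holds exactly if all \<open>k j\<close> vanish, and then
  both sides are \<open>1\<close> because \<open>0 ^ 0 = 1\<close>; otherwise both sides are \<open>0\<close>.
\<close>

lemma power_eq_prod_powr:
  fixes t :: real and k :: "'a \<Rightarrow> nat"
  assumes "finite S" and w: "\<And>j. j \<in> S \<Longrightarrow> w j > 0" and t: "t \<ge> 0"
    and m: "real m = (\<Sum>j\<in>S. w j * real (k j))"
  shows "t ^ m = (\<Prod>j\<in>S. (t ^ k j) powr w j)"
proof (cases "t = 0")
  case False
  with t have "t > 0" by simp
  then have "t ^ m = t powr (\<Sum>j\<in>S. w j * real (k j))"
    by (simp add: powr_realpow flip: m)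
  also have "\<dots> = (\<Prod>j\<in>S. t powr (w j * real (k j)))"
    using False by (rule powr_sum)
  also have "\<dots> = (\<Prod>j\<in>S. (t ^ k j) powr w j)"
    using \<open>t > 0\<close> by (intro prod.cong) (auto simp: powr_powr mult.commute simp flip: powr_realpow)
  finally show ?thesis .
next
  case True
  show ?thesis
  proof (cases "\<forall>j\<in>S. k j = 0")
    case all0: True
    with m have "m = 0" by simp
    with all0 show ?thesis by simp
  next
    case False
    then obtain j where j: "j \<in> S" "k j > 0" by blast
    have "(\<Sum>j\<in>S. w j * real (k j)) > 0"
      using \<open>finite S\<close> j w by (intro sum_pos2[of S j]) (auto simp: less_imp_le)
    then have "m > 0" using m by simp
    moreover have "(\<Prod>j\<in>S. (t ^ k j) powr w j) = 0"
      using \<open>finite S\<close> j True by (auto simp: prod_zero_iff intro!: bexI[of _ j])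
    ultimately show ?thesis using True by simp
  qed
qed

section \<open>Barycentric coordinates and monomials\<close>

lemma is_bary_bary:
  fixes A :: "nat \<Rightarrow> nat ^ 'n::finite"
  assumes "aff_indep_family A" and "point \<alpha> \<in> convex hull (point ` A ` {0..CARD('n)})"
  shows "is_bary A \<alpha> (bary A \<alpha>)"
  unfolding bary_def by (rule theI'[OF bary_unique[OF assms]])

context
  fixes A :: "nat \<Rightarrow> nat ^ 'n::finite" and \<alpha> :: "nat ^ 'n"
  assumes bary: "is_bary A \<alpha> (bary A \<alpha>)"
begin

lemma finite_nz: "finite (nz A \<alpha>)"
  by (simp add: nz_def)

lemma bary_pos: "j \<in> nz A \<alpha> \<Longrightarrow> bary A \<alpha> j > 0"
  using bary by (auto simp: nz_def is_bary_def less_le)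

lemma sum_bary_nz: "sum (bary A \<alpha>) (nz A \<alpha>) = 1"
proof -
  have "sum (bary A \<alpha>) (nz A \<alpha>) = (\<Sum>j=0..CARD('n). bary A \<alpha> j)"
    by (rule sum.mono_neutral_left) (auto simp: nz_def)
  then show ?thesis using bary by (simp add: is_bary_def)
qed

lemma point_eq_sum_nz: "point \<alpha> = (\<Sum>j\<in>nz A \<alpha>. bary A \<alpha> j *\<^sub>R point (A j))"
proof -
  have "(\<Sum>j\<in>nz A \<alpha>. bary A \<alpha> j *\<^sub>R point (A j)) = (\<Sum>j=0..CARD('n). bary A \<alpha> j *\<^sub>R point (A j))"
    by (rule sum.mono_neutral_left) (auto simp: nz_def)
  then show ?thesis using bary by (simp add: is_bary_def)
qed

lemma component_eq_sum_nz: "real (\<alpha> $ i) = (\<Sum>j\<in>nz A \<alpha>. bary A \<alpha> j * real (A j $ i))"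
  using arg_cong[OF point_eq_sum_nz, of "\<lambda>v. v $ i"] by (simp add: point_def)

end

lemma abs_monom_eval: "\<bar>monom_eval x \<alpha>\<bar> = (\<Prod>i\<in>UNIV. \<bar>x $ i\<bar> ^ (\<alpha> $ i))"
  by (simp add: monom_eval_def abs_prod power_abs)

lemma monom_eval_even:
  assumes "even_exponent \<alpha>"
  shows "monom_eval x \<alpha> = (\<Prod>i\<in>UNIV. \<bar>x $ i\<bar> ^ (\<alpha> $ i))"
  using assms by (simp add: monom_eval_def even_exponent_def power_even_abs)

lemma monom_eval_even_nonneg: "even_exponent \<alpha> \<Longrightarrow> monom_eval x \<alpha> \<ge> 0"
  by (simp add: monom_eval_even prod_nonneg)

text \<open>
  The exponent of each variable in \<open>\<alpha>\<close> is the weighted mean of its exponents in the vertices.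
  The product runs over \<open>nz A \<alpha>\<close> only: a vertex of weight \<open>0\<close> would contribute
  \<open>0 powr 0 = 0\<close> at points where its monomial vanishes.
\<close>

lemma abs_monom_eval_eq_prod_vertices:
  assumes bary: "is_bary A \<alpha> (bary A \<alpha>)" and ev: "\<And>j. j \<in> nz A \<alpha> \<Longrightarrow> even_exponent (A j)"
  shows "\<bar>monom_eval x \<alpha>\<bar> = (\<Prod>j\<in>nz A \<alpha>. monom_eval x (A j) powr bary A \<alpha> j)"
proof -
  have "\<bar>monom_eval x \<alpha>\<bar>
      = (\<Prod>i\<in>UNIV. \<Prod>j\<in>nz A \<alpha>. (\<bar>x $ i\<bar> ^ (A j $ i)) powr bary A \<alpha> j)"
    unfolding abs_monom_eval
    by (intro prod.cong refl power_eq_prod_powr finite_nz[OF bary] component_eq_sum_nz[OF bary])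
      (auto simp: bary_pos[OF bary])
  also have "\<dots> = (\<Prod>j\<in>nz A \<alpha>. \<Prod>i\<in>UNIV. (\<bar>x $ i\<bar> ^ (A j $ i)) powr bary A \<alpha> j)"
    by (rule prod.swap)
  also have "\<dots> = (\<Prod>j\<in>nz A \<alpha>. monom_eval x (A j) powr bary A \<alpha> j)"
    by (intro prod.cong refl) (simp add: monom_eval_even ev prod_powr_distrib)
  finally show ?thesis .
qed

text \<open>
  Insert \<open>(b j / bary A \<alpha> j) * x\<^bsup>A j\<^esup>\<close> into the inequality of the means with weights \<open>bary A \<alpha> j\<close>:
  the geometric mean is the circuit number times \<open>\<bar>x\<^sup>\<alpha>\<bar>\<close>, the arithmetic mean is the part of the
  sum over the vertices in \<open>nz A \<alpha>\<close>, and the other vertices only add nonnegative terms.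
\<close>

lemma circuit_number_bound:
  fixes A :: "nat \<Rightarrow> nat ^ 'n::finite"
  assumes bary: "is_bary A \<alpha> (bary A \<alpha>)"
    and ev: "\<And>j. j \<le> CARD('n) \<Longrightarrow> even_exponent (A j)"
    and b: "\<And>j. j \<le> CARD('n) \<Longrightarrow> b j \<ge> 0"
    and c: "\<bar>c\<bar> \<le> (\<Prod>j\<in>nz A \<alpha>. (b j / bary A \<alpha> j) powr bary A \<alpha> j)"
  shows "(\<Sum>j=0..CARD('n). b j * monom_eval x (A j)) + c * monom_eval x \<alpha> \<ge> 0"
proof -
  let ?l = "bary A \<alpha>" and ?M = "\<lambda>j. monom_eval x (A j)"
  have nz: "j \<le> CARD('n)" if "j \<in> nz A \<alpha>" for j
    using that by (simp add: nz_def)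
  have M: "?M j \<ge> 0" if "j \<le> CARD('n)" for j
    using that ev by (simp add: monom_eval_even_nonneg)
  have "\<bar>c * monom_eval x \<alpha>\<bar> \<le> (\<Prod>j\<in>nz A \<alpha>. (b j / ?l j) powr ?l j) * (\<Prod>j\<in>nz A \<alpha>. ?M j powr ?l j)"
    using c abs_monom_eval_eq_prod_vertices[OF bary, of x] ev nz
    by (simp add: abs_mult mult_right_mono prod_nonneg)
  also have "\<dots> = (\<Prod>j\<in>nz A \<alpha>. (b j / ?l j * ?M j) powr ?l j)"
    unfolding prod.distrib[symmetric] powr_mult ..
  also have "\<dots> \<le> (\<Sum>j\<in>nz A \<alpha>. ?l j * (b j / ?l j * ?M j))"
    using b M nz bary_pos[OF bary] sum_bary_nz[OF bary] finite_nz[OF bary]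
    by (intro weighted_geometric_le_arithmetic_mean) (auto simp: less_imp_le)
  also have "\<dots> = (\<Sum>j\<in>nz A \<alpha>. b j * ?M j)"
    using bary_pos[OF bary] by (intro sum.cong refl) (auto simp: nz_def)
  also have "\<dots> \<le> (\<Sum>j=0..CARD('n). b j * ?M j)"
    using b M nz by (intro sum_mono2) auto
  finally show ?thesis by linarith
qed

section \<open>Polynomials supported on a simplex\<close>

text \<open>
  The coefficients are kept as data separate from the polynomial because the summands of the
  decomposition use the same family \<open>A\<close> and the same \<open>c\<close>, but different \<open>b\<close>.
\<close>

definition simplex_polynomial ::
    "(nat \<Rightarrow> nat ^ 'n::finite) \<Rightarrow> (nat \<Rightarrow> real) \<Rightarrow> (nat ^ 'n) set \<Rightarrow> (nat ^ 'n \<Rightarrow> real) \<Rightarrow> 'n rpoly" where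
  "simplex_polynomial A b D c =
     (\<Sum>j=0..CARD('n). Poly_Mapping.single (A j) (b j)) + (\<Sum>\<alpha>\<in>D. Poly_Mapping.single \<alpha> (c \<alpha>))"

text \<open>
  The conditions on the data that make \<open>simplex_polynomial A b D c\<close> an ST-polynomial with
  \<open>D\<close> as its set of exponents that are not monomial squares. Vanishing \<open>b j\<close> are allowed, so
  the same vertices serve for polynomials whose Newton polytope is a proper face of the simplex.
\<close>

locale ST_data =
  fixes A :: "nat \<Rightarrow> nat ^ 'n::finite" and b :: "nat \<Rightarrow> real"
    and D :: "(nat ^ 'n) set" and c :: "nat ^ 'n \<Rightarrow> real"
  assumes A_0: "A 0 = 0"
    and indep: "aff_indep_family A"
    and even_A: "j \<le> CARD('n) \<Longrightarrow> even_exponent (A j)"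
    and b_nonneg: "j \<le> CARD('n) \<Longrightarrow> b j \<ge> 0"
    and finite_D: "finite D"
    and A_notin_D: "j \<le> CARD('n) \<Longrightarrow> A j \<notin> D"
    and not_square: "\<alpha> \<in> D \<Longrightarrow> c \<alpha> < 0 \<or> \<not> even_exponent \<alpha> \<and> c \<alpha> > 0"
    and D_hull: "\<alpha> \<in> D \<Longrightarrow> point \<alpha> \<in> convex hull (point ` A ` {0..CARD('n)})"
    and b_support: "\<alpha> \<in> D \<Longrightarrow> j \<le> CARD('n) \<Longrightarrow> b j = 0 \<Longrightarrow> bary A \<alpha> j = 0"
begin

abbreviation P :: "'n rpoly" where
  "P \<equiv> simplex_polynomial A b D c"

definition supp :: "nat set" where
  "supp = {j \<in> {0..CARD('n)}. b j \<noteq> 0}"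

lemma A_inj: "i \<le> CARD('n) \<Longrightarrow> j \<le> CARD('n) \<Longrightarrow> A i = A j \<longleftrightarrow> i = j"
  using indep by (auto simp: aff_indep_family_def inj_on_def)

lemma coeff_P:
  "coeff_of P \<beta> = (\<Sum>j=0..CARD('n). b j when A j = \<beta>) + (\<Sum>\<alpha>\<in>D. c \<alpha> when \<alpha> = \<beta>)"
  by (simp add: simplex_polynomial_def lookup_add lookup_sum lookup_single)

lemma coeff_vertex:
  assumes "j \<le> CARD('n)"
  shows "coeff_of P (A j) = b j"
proof -
  have "(\<Sum>i=0..CARD('n). b i when A i = A j) = (\<Sum>i=0..CARD('n). if i = j then b i else 0)"
    using assms A_inj by (intro sum.cong) (auto simp: when_def)
  moreover have "(\<Sum>\<alpha>\<in>D. c \<alpha> when \<alpha> = A j) = 0"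
    using A_notin_D[OF assms] by (intro sum.neutral) (auto simp: when_def)
  ultimately show ?thesis using assms by (simp add: coeff_P)
qed

lemma coeff_inner:
  assumes "\<beta> \<in> D"
  shows "coeff_of P \<beta> = c \<beta>"
proof -
  have "(\<Sum>i=0..CARD('n). b i when A i = \<beta>) = 0"
    using assms A_notin_D by (intro sum.neutral) (auto simp: when_def)
  moreover have "(\<Sum>\<alpha>\<in>D. c \<alpha> when \<alpha> = \<beta>) = (\<Sum>\<alpha>\<in>D. if \<alpha> = \<beta> then c \<alpha> else 0)"
    by (intro sum.cong) (auto simp: when_def)
  ultimately show ?thesis using assms finite_D by (simp add: coeff_P)
qed

lemma coeff_outside: "\<beta> \<notin> A ` {0..CARD('n)} \<Longrightarrow> \<beta> \<notin> D \<Longrightarrow> coeff_of P \<beta> = 0"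
  unfolding coeff_P
  by (subst sum.neutral, force simp: when_def, subst sum.neutral) (auto simp: when_def)

lemma keys_P: "Poly_Mapping.keys P = A ` supp \<union> D"
proof -
  have "coeff_of P \<beta> \<noteq> 0 \<longleftrightarrow> \<beta> \<in> A ` supp \<union> D" for \<beta>
  proof (cases "\<beta> \<in> A ` {0..CARD('n)}")
    case True
    then show ?thesis
      using A_inj A_notin_D by (auto simp: coeff_vertex supp_def)
  next
    case False
    then show ?thesis
      using not_square[of \<beta>] by (cases "\<beta> \<in> D") (auto simp: coeff_inner coeff_outside supp_def)
  qed
  then show ?thesis by (auto simp: in_keys_iff)
qed

lemma Delta_P: "Delta P = D"
proof -
  have "\<beta> \<in> Delta P \<longleftrightarrow> \<beta> \<in> D" if "\<beta> \<in> A ` supp \<union> D" for \<beta>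
  proof (cases "\<beta> \<in> D")
    case True
    then show ?thesis using not_square[OF True] by (auto simp: Delta_def keys_P coeff_inner)
  next
    case False
    with that obtain j where "j \<le> CARD('n)" "\<beta> = A j" by (auto simp: supp_def)
    then show ?thesis
      using False b_nonneg[of j] even_A[of j] by (simp add: Delta_def coeff_vertex)
  qed
  then show ?thesis by (auto simp: Delta_def keys_P)
qed

lemma ST_poly_P: "ST_poly A P"
proof -
  have "{0..CARD('n)} = insert 0 {1..CARD('n)}" by auto
  then have "P = Poly_Mapping.single 0 (b 0) + (\<Sum>j=1..CARD('n). Poly_Mapping.single (A j) (b j))
      + (\<Sum>\<alpha>\<in>D. Poly_Mapping.single \<alpha> (c \<alpha>))"
    by (simp add: simplex_polynomial_def A_0)
  also have "b 0 = coeff_of P 0"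
    using coeff_vertex[of 0] A_0 by simp
  also have "(\<Sum>j=1..CARD('n). Poly_Mapping.single (A j) (b j))
      = (\<Sum>j=1..CARD('n). Poly_Mapping.single (A j) (coeff_of P (A j)))"
    by (intro sum.cong) (auto simp: coeff_vertex)
  also have "(\<Sum>\<alpha>\<in>D. Poly_Mapping.single \<alpha> (c \<alpha>)) = (\<Sum>\<alpha>\<in>D. Poly_Mapping.single \<alpha> (coeff_of P \<alpha>))"
    by (intro sum.cong) (auto simp: coeff_inner)
  finally show ?thesis
    using A_0 indep even_A D_hull b_nonneg b_support
    unfolding ST_poly_def Delta_P by (auto simp: coeff_vertex)
qed

lemma is_bary_D: "\<alpha> \<in> D \<Longrightarrow> is_bary A \<alpha> (bary A \<alpha>)"
  by (intro is_bary_bary indep D_hull)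

lemma nz_subset_supp: "\<alpha> \<in> D \<Longrightarrow> nz A \<alpha> \<subseteq> supp"
  using b_support by (auto simp: nz_def supp_def)

text \<open>
  By the condition on vanishing \<open>b j\<close>, every inner exponent is already a convex combination of
  vertices that occur in the polynomial, so inner exponents do not enlarge the hull.
\<close>

lemma New_P: "New P = convex hull (point ` A ` supp)"
proof -
  have "point \<alpha> \<in> convex hull (point ` A ` supp)" if "\<alpha> \<in> D" for \<alpha>
    unfolding point_eq_sum_nz[OF is_bary_D[OF that]]
    using nz_subset_supp[OF that] bary_pos[OF is_bary_D[OF that]]
      sum_bary_nz[OF is_bary_D[OF that]] finite_nz[OF is_bary_D[OF that]]
    by (intro convex_sum) (auto intro: less_imp_le hull_inc)
  then show ?thesis
    unfolding New_def keys_P image_Un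
    by (intro antisym hull_minimal Un_least hull_mono) (auto intro: hull_inc)
qed

lemma affine_independent_vertices: "K \<subseteq> {0..CARD('n)} \<Longrightarrow> \<not> affine_dependent (point ` A ` K)"
  using indep affine_dependent_subset[OF _ image_mono[OF image_mono]]
  unfolding aff_indep_family_def by blast

lemma vertices_P: "vertices P = point ` A ` supp"
  unfolding vertices_def New_P
  by (subst extreme_point_of_convex_hull_affine_independent[OF affine_independent_vertices])
    (auto simp: supp_def)

lemma poly_eval_P:
  "poly_eval P x = (\<Sum>j=0..CARD('n). b j * monom_eval x (A j)) + (\<Sum>\<alpha>\<in>D. c \<alpha> * monom_eval x \<alpha>)"
proof -
  have inj: "inj_on A {0..CARD('n)}"
    using indep by (simp add: aff_indep_family_def)
  have "poly_eval P x = (\<Sum>\<alpha>\<in>A ` {0..CARD('n)} \<union> D. coeff_of P \<alpha> * monom_eval x \<alpha>)"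
    unfolding poly_eval_def using finite_D
    by (intro sum.mono_neutral_left) (auto simp: keys_P supp_def coeff_vertex)
  also have "\<dots> = (\<Sum>\<alpha>\<in>A ` {0..CARD('n)}. coeff_of P \<alpha> * monom_eval x \<alpha>)
      + (\<Sum>\<alpha>\<in>D. coeff_of P \<alpha> * monom_eval x \<alpha>)"
    using finite_D A_notin_D by (intro sum.union_disjoint) auto
  finally show ?thesis
    by (simp add: sum.reindex[OF inj] coeff_vertex coeff_inner)
qed

lemma nonneg_of_no_inner: "D = {} \<Longrightarrow> nonneg_poly P"
  using b_nonneg even_A unfolding nonneg_poly_def poly_eval_P
  by (auto intro!: sum_nonneg mult_nonneg_nonneg monom_eval_even_nonneg)

lemma nonneg_of_one_inner:
  assumes "D = {\<alpha>}"
    and "\<bar>c \<alpha>\<bar> \<le> (\<Prod>j\<in>nz A \<alpha>. (b j / bary A \<alpha> j) powr bary A \<alpha> j)"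
  shows "nonneg_poly P"
  unfolding nonneg_poly_def poly_eval_P
proof
  fix x
  have "is_bary A \<alpha> (bary A \<alpha>)" using is_bary_D assms(1) by simp
  from circuit_number_bound[OF this even_A b_nonneg assms(2), of x]
  show "(\<Sum>j=0..CARD('n). b j * monom_eval x (A j)) + (\<Sum>\<alpha>\<in>D. c \<alpha> * monom_eval x \<alpha>) \<ge> 0"
    using assms(1) by simp
qed

lemma New_face:
  assumes "supp \<subseteq> K" and "K \<subseteq> {0..CARD('n)}"
  shows "New P face_of convex hull (point ` A ` K)"
  unfolding New_P face_of_convex_hull_affine_independent[OF affine_independent_vertices[OF assms(2)]]
  using assms(1) by (intro exI[of _ "point ` A ` supp"] conjI image_mono refl)

end

lemma ST_data_of_ST_poly:
  fixes A :: "nat \<Rightarrow> nat ^ 'n::finite"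
  assumes "ST_poly A f"
  shows "ST_data A (\<lambda>j. coeff_of f (A j)) (Delta f) (coeff_of f)"
    and "f = simplex_polynomial A (\<lambda>j. coeff_of f (A j)) (Delta f) (coeff_of f)"
proof -
  show "ST_data A (\<lambda>j. coeff_of f (A j)) (Delta f) (coeff_of f)"
    using assms unfolding ST_poly_def
    by unfold_locales (auto simp: Delta_def dest: leD)
  have "{0..CARD('n)} = insert 0 {1..CARD('n)}" by auto
  then show "f = simplex_polynomial A (\<lambda>j. coeff_of f (A j)) (Delta f) (coeff_of f)"
    using assms unfolding ST_poly_def by (simp add: simplex_polynomial_def)
qed

section \<open>Splitting into circuit polynomials\<close>

text \<open>
  Everything that is left over may go to a single index, since no upper bound on the individual
  \<open>b \<alpha> j\<close> is asked for.
\<close>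

lemma distribute_surplus:
  fixes w :: "'a \<Rightarrow> 'b \<Rightarrow> real"
  assumes "finite D" and "D \<noteq> {}" and "\<And>j. j \<in> J \<Longrightarrow> (\<Sum>\<alpha>\<in>D. w \<alpha> j) \<le> B j"
  shows "\<exists>b. (\<forall>\<alpha>. \<forall>j\<in>J. w \<alpha> j \<le> b \<alpha> j) \<and> (\<forall>j. (\<Sum>\<alpha>\<in>D. b \<alpha> j) = B j)"
proof -
  obtain \<alpha>\<^sub>0 where \<alpha>\<^sub>0: "\<alpha>\<^sub>0 \<in> D" using \<open>D \<noteq> {}\<close> by blast
  define b where "b \<alpha> j = w \<alpha> j + (if \<alpha> = \<alpha>\<^sub>0 then B j - (\<Sum>\<alpha>\<in>D. w \<alpha> j) else 0)" for \<alpha> j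
  have "w \<alpha> j \<le> b \<alpha> j" if "j \<in> J" for \<alpha> j
    using assms(3)[OF that] by (simp add: b_def)
  moreover have "(\<Sum>\<alpha>\<in>D. b \<alpha> j) = B j" for j
    using \<open>finite D\<close> \<alpha>\<^sub>0 by (simp add: b_def sum.distrib)
  ultimately show ?thesis by blast
qed

lemma sum_simplex_polynomials:
  assumes "\<And>j. (\<Sum>\<alpha>\<in>D. b \<alpha> j) = B j"
  shows "(\<Sum>\<alpha>\<in>D. simplex_polynomial A (b \<alpha>) {\<alpha>} c) = simplex_polynomial A B D c"
proof -
  have "(\<Sum>\<alpha>\<in>D. Poly_Mapping.single (A j) (b \<alpha> j)) = Poly_Mapping.single (A j) (B j)" for j
    by (rule poly_mapping_eqI)
      (auto simp: lookup_sum lookup_single when_def simp flip: assms)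
  then show ?thesis
    by (simp add: simplex_polynomial_def sum.distrib sum.swap[of _ _ D])
qed

text \<open>
  The constant \<open>w 0\<close> is the solution of the equation \<open>\<bar>c\<bar> = circuit number\<close> for the coefficient at
  vertex \<open>0\<close>: raising \<open>w 0 / bary A \<alpha> 0\<close> to the power \<open>bary A \<alpha> 0\<close> gives \<open>\<bar>c\<bar>\<close> times the inverse of
  the product over the other vertices.
\<close>

lemma circuit_number_with_constant:
  fixes A :: "nat \<Rightarrow> nat ^ 'n::finite"
  assumes bary: "is_bary A \<alpha> (bary A \<alpha>)" and nz0: "0 \<in> nz A \<alpha>"
    and w: "\<And>j. j \<in> nz A \<alpha> \<Longrightarrow> j \<ge> 1 \<Longrightarrow> w j > 0"
    and w0: "w 0 = bary A \<alpha> 0 * \<bar>c\<bar> powr (1 / bary A \<alpha> 0) *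
      (\<Prod>j\<in>{j \<in> nz A \<alpha>. j \<ge> 1}. (bary A \<alpha> j / w j) powr (bary A \<alpha> j / bary A \<alpha> 0))"
  shows "\<bar>c\<bar> = (\<Prod>j\<in>nz A \<alpha>. (w j / bary A \<alpha> j) powr bary A \<alpha> j)"
proof -
  let ?l = "bary A \<alpha>" and ?S = "{j \<in> nz A \<alpha>. j \<ge> 1}"
  have l: "?l j > 0" if "j \<in> nz A \<alpha>" for j
    using bary_pos[OF bary that] .
  have l0: "?l 0 > 0" using l nz0 by blast
  have split: "nz A \<alpha> = insert 0 ?S" using nz0 by auto
  have "w 0 / ?l 0 = \<bar>c\<bar> powr (1 / ?l 0) * (\<Prod>j\<in>?S. (?l j / w j) powr (?l j / ?l 0))"
    using l0 w0 by simp
  then have "(w 0 / ?l 0) powr ?l 0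
      = (\<bar>c\<bar> powr (1 / ?l 0)) powr ?l 0 * (\<Prod>j\<in>?S. (?l j / w j) powr (?l j / ?l 0)) powr ?l 0"
    by (simp add: powr_mult prod_nonneg)
  also have "\<dots> = \<bar>c\<bar> * (\<Prod>j\<in>?S. (?l j / w j) powr ?l j)"
    using l0 by (simp add: powr_powr prod_powr_distrib)
  finally have *: "(w 0 / ?l 0) powr ?l 0 = \<bar>c\<bar> * (\<Prod>j\<in>?S. (?l j / w j) powr ?l j)" .
  have "(\<Prod>j\<in>nz A \<alpha>. (w j / ?l j) powr ?l j)
      = (w 0 / ?l 0) powr ?l 0 * (\<Prod>j\<in>?S. (w j / ?l j) powr ?l j)"
    using finite_nz[OF bary] by (subst split) (subst prod.insert, auto)
  also have "\<dots> = \<bar>c\<bar> * (\<Prod>j\<in>?S. (?l j / w j) powr ?l j * (w j / ?l j) powr ?l j)"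
    by (simp add: * prod.distrib)
  also have "(\<Prod>j\<in>?S. (?l j / w j) powr ?l j * (w j / ?l j) powr ?l j) = 1"
  proof (intro prod.neutral ballI)
    fix j assume "j \<in> ?S"
    then have "?l j > 0" "w j > 0" using l w by auto
    then show "(?l j / w j) powr ?l j * (w j / ?l j) powr ?l j = 1"
      by (simp flip: powr_mult)
  qed
  finally show ?thesis by simp
qed


theorem theorem3p4:
  fixes f :: "'n::finite rpoly"
    and A :: "nat \<Rightarrow> nat ^ 'n"
    and a :: "nat ^ 'n \<Rightarrow> nat \<Rightarrow> real"
    and r :: real
  assumes "ST_poly A f"
    and "\<forall>\<alpha>\<in>Delta f. \<forall>j\<in>{1..CARD('n)}. a \<alpha> j \<ge> 0"
    and "\<forall>\<alpha>\<in>Delta f. \<forall>j\<in>{1..CARD('n)}. bary A \<alpha> j > 0 \<longrightarrow> a \<alpha> j > 0"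
    and "\<forall>\<alpha>\<in>Delta f. bary A \<alpha> 0 = 0 \<longrightarrow>
           \<bar>coeff_of f \<alpha>\<bar> \<le> (\<Prod>j\<in>{j \<in> nz A \<alpha>. j \<ge> 1}. (a \<alpha> j / bary A \<alpha> j) powr bary A \<alpha> j)"
    and "\<forall>j\<in>{1..CARD('n)}. coeff_of f (A j) \<ge> (\<Sum>\<alpha>\<in>Delta f. a \<alpha> j)"
    and "coeff_of f 0 - r \<ge>
           (\<Sum>\<alpha>\<in>{\<alpha> \<in> Delta f. 0 \<in> nz A \<alpha>}.
              bary A \<alpha> 0 * \<bar>coeff_of f \<alpha>\<bar> powr (1 / bary A \<alpha> 0) *
              (\<Prod>j\<in>{j \<in> nz A \<alpha>. j \<ge> 1}.
                 (bary A \<alpha> j / a \<alpha> j) powr (bary A \<alpha> j / bary A \<alpha> 0)))"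
  shows "\<exists>g :: nat \<Rightarrow> 'n rpoly.
           f - Poly_Mapping.single 0 r = (\<Sum>i<max 1 (card (Delta f)). g i) \<and>
           (\<forall>i<max 1 (card (Delta f)).
              nonneg_poly (g i) \<and> circuit_poly (g i) \<and>
              New (g i) face_of (convex hull ({0} \<union> vertices f)))"
proof -
  let ?D = "Delta f" and ?N = "max 1 (card (Delta f))"
  \<comment> \<open>\<open>B j\<close> is what \<open>f - r\<close> offers at vertex \<open>j\<close>, and \<open>w \<alpha> j\<close> the part of it reserved for \<open>\<alpha>\<close>.\<close>
  define B where "B j = coeff_of f (A j) - (if j = 0 then r else 0)" for j
  define w where "w \<alpha> j =
    (if j = 0 then
       (if 0 \<in> nz A \<alpha> then bary A \<alpha> 0 * \<bar>coeff_of f \<alpha>\<bar> powr (1 / bary A \<alpha> 0) *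
          (\<Prod>j\<in>{j \<in> nz A \<alpha>. j \<ge> 1}. (bary A \<alpha> j / a \<alpha> j) powr (bary A \<alpha> j / bary A \<alpha> 0))
        else 0)
     else a \<alpha> j)" for \<alpha> j
  interpret f: ST_data A "\<lambda>j. coeff_of f (A j)" ?D "coeff_of f"
    by (rule ST_data_of_ST_poly(1)[OF assms(1)])
  note f_eq = ST_data_of_ST_poly(2)[OF assms(1)]
  \<comment> \<open>The vertex \<open>0\<close> is added because \<open>f - r\<close> can have a constant term even if \<open>f\<close> has none.\<close>
  define K where "K = insert 0 f.supp"
  have K: "K \<subseteq> {0..CARD('n)}" by (auto simp: K_def f.supp_def)
  have K_hull: "convex hull ({0} \<union> vertices f) = convex hull (point ` A ` K)"
  proof -
    have "point (A 0) = 0" by (simp add: f.A_0 point_def vec_eq_iff)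
    then show ?thesis using f.vertices_P by (simp add: K_def flip: f_eq)
  qed
  have split: "f - Poly_Mapping.single 0 r = simplex_polynomial A B ?D (coeff_of f)"
  proof -
    have "{0..CARD('n)} = insert 0 {1..CARD('n)}" by auto
    then show ?thesis
      by (subst f_eq) (simp add: simplex_polynomial_def B_def f.A_0 single_diff)
  qed
  have nzD: "\<alpha> \<in> ?D \<Longrightarrow> j \<in> nz A \<alpha> \<Longrightarrow> j \<ge> 1 \<Longrightarrow> a \<alpha> j > 0" for \<alpha> j
    using assms(3) bary_pos[OF f.is_bary_D] by (auto simp: nz_def)
  have w_nonneg: "w \<alpha> j \<ge> 0" if "\<alpha> \<in> ?D" "j \<le> CARD('n)" for \<alpha> j
    using that assms(2) bary_pos[OF f.is_bary_D] 
    by (auto simp: w_def less_imp_le intro!: mult_nonneg_nonneg prod_nonneg)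
  have w_pos: "w \<alpha> j > 0" if "\<alpha> \<in> ?D" "j \<in> nz A \<alpha>" for \<alpha> j
  proof (cases "j = 0")
    case True
    have "(\<Prod>i\<in>{i \<in> nz A \<alpha>. i \<ge> 1}. (bary A \<alpha> i / a \<alpha> i) powr (bary A \<alpha> i / bary A \<alpha> 0)) > 0"
      using nzD[OF that(1)] bary_pos[OF f.is_bary_D[OF that(1)]]
      by (intro prod_pos) (force intro: divide_pos_pos)
    moreover have "coeff_of f \<alpha> \<noteq> 0"
      using f.not_square[OF that(1)] by auto
    ultimately show ?thesis
      using True that bary_pos[OF f.is_bary_D[OF that(1)]] by (simp add: w_def)
  next
    case False
    then show ?thesis using nzD[OF that] by (simp add: w_def)
  qed
  have w_sum: "(\<Sum>\<alpha>\<in>?D. w \<alpha> j) \<le> B j" if "j \<in> {0..CARD('n)}" for j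
  proof (cases "j = 0")
    case True
    then show ?thesis
      using assms(6) unfolding sum.inter_filter[OF f.finite_D] by (simp add: w_def B_def f.A_0)
  next
    case False
    with that assms(5) show ?thesis by (simp add: w_def B_def)
  qed
  have w_bound: "\<bar>coeff_of f \<alpha>\<bar> \<le> (\<Prod>j\<in>nz A \<alpha>. (w \<alpha> j / bary A \<alpha> j) powr bary A \<alpha> j)"
    if \<alpha>: "\<alpha> \<in> ?D" for \<alpha>
  proof (cases "0 \<in> nz A \<alpha>")
    case True
    have "\<bar>coeff_of f \<alpha>\<bar> = (\<Prod>j\<in>nz A \<alpha>. (w \<alpha> j / bary A \<alpha> j) powr bary A \<alpha> j)"
      using True nzD[OF \<alpha>]
      by (intro circuit_number_with_constant f.is_bary_D \<alpha>) (auto simp: w_def intro!: prod.cong)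
    then show ?thesis by simp
  next
    case False
    then have "{j \<in> nz A \<alpha>. j \<ge> 1} = nz A \<alpha>" and "bary A \<alpha> 0 = 0"
      by (auto simp: nz_def Suc_le_eq intro: gr0I)
    moreover have "(\<Prod>j\<in>nz A \<alpha>. (w \<alpha> j / bary A \<alpha> j) powr bary A \<alpha> j)
        = (\<Prod>j\<in>nz A \<alpha>. (a \<alpha> j / bary A \<alpha> j) powr bary A \<alpha> j)"
      using False by (intro prod.cong) (auto simp: w_def)
    ultimately show ?thesis using assms(4) \<alpha> by auto
  qed
  show ?thesis
  proof (cases "?D = {}")
    case True
    \<comment> \<open>A sum of monomial squares is itself a circuit polynomial.\<close>
    have B_nonneg: "B j \<ge> 0" if "j \<le> CARD('n)" for j
      using w_sum[of j] that True by simp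
    interpret g: ST_data A B "{}" "coeff_of f"
      using f.A_0 f.indep f.even_A B_nonneg by unfold_locales auto
    have "g.supp \<subseteq> K" by (auto simp: K_def g.supp_def f.supp_def B_def)
    then show ?thesis
      using g.ST_poly_P g.Delta_P g.nonneg_of_no_inner g.New_face K split True
      unfolding K_hull circuit_poly_def
      by (intro exI[of _ "\<lambda>_. g.P"]) auto
  next
    case False
    have "\<exists>b. (\<forall>\<alpha>. \<forall>j\<in>{0..CARD('n)}. w \<alpha> j \<le> b \<alpha> j) \<and> (\<forall>j. (\<Sum>\<alpha>\<in>?D. b \<alpha> j) = B j)"
      using f.finite_D False w_sum by (rule distribute_surplus)
    then obtain b where wb: "\<And>\<alpha> j. j \<in> {0..CARD('n)} \<Longrightarrow> w \<alpha> j \<le> b \<alpha> j"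
      and bB: "\<And>j. (\<Sum>\<alpha>\<in>?D. b \<alpha> j) = B j"
      by (metis (no_types))
    define G where "G \<alpha> = simplex_polynomial A (b \<alpha>) {\<alpha>} (coeff_of f)" for \<alpha>
    have G: "nonneg_poly (G \<alpha>) \<and> circuit_poly (G \<alpha>) \<and>
        New (G \<alpha>) face_of convex hull ({0} \<union> vertices f)" if \<alpha>: "\<alpha> \<in> ?D" for \<alpha>
    proof -
      have b_nonneg: "b \<beta> j \<ge> 0" if "\<beta> \<in> ?D" "j \<le> CARD('n)" for \<beta> j
        using w_nonneg[OF that] wb[of j \<beta>] that by simp
      have b_pos: "b \<alpha> j > 0" if "j \<in> nz A \<alpha>" for j
        using w_pos[OF \<alpha> that] wb[of j \<alpha>] that by (simp add: nz_def)
      interpret g: ST_data A "b \<alpha>" "{\<alpha>}" "coeff_of f"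
      proof unfold_locales
        show "bary A \<beta> j = 0" if "\<beta> \<in> {\<alpha>}" "j \<le> CARD('n)" "b \<alpha> j = 0" for \<beta> j
          using that b_pos[of j] by (auto simp: nz_def)
        show "A j \<notin> {\<alpha>}" if "j \<le> CARD('n)" for j
          using f.A_notin_D[OF that] \<alpha> by auto
      qed (use \<alpha> f.A_0 f.indep f.even_A b_nonneg f.not_square f.D_hull in auto)
      have "(w \<alpha> j / bary A \<alpha> j) powr bary A \<alpha> j \<le> (b \<alpha> j / bary A \<alpha> j) powr bary A \<alpha> j"
        if "j \<in> nz A \<alpha>" for j
        using that bary_pos[OF f.is_bary_D[OF \<alpha>] that] w_pos[OF \<alpha> that] wb[of j \<alpha>]
        by (intro powr_mono2 divide_right_mono) (auto simp: nz_def)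
      then have "\<bar>coeff_of f \<alpha>\<bar> \<le> (\<Prod>j\<in>nz A \<alpha>. (b \<alpha> j / bary A \<alpha> j) powr bary A \<alpha> j)"
        using w_bound[OF \<alpha>] by (elim order_trans) (intro prod_mono, auto)
      then have nn: "nonneg_poly (G \<alpha>)"
        unfolding G_def by (intro g.nonneg_of_one_inner) auto
      \<comment> \<open>As no summand is negative at a vertex, a vertex used by one summand is not lost by
        cancellation in \<open>f - r\<close>.\<close>
      have "b \<alpha> j \<le> B j" if "j \<le> CARD('n)" for j
        unfolding bB[symmetric] using \<alpha> f.finite_D b_nonneg that by (intro member_le_sum) auto
      then have "g.supp \<subseteq> K"
        using b_nonneg[OF \<alpha>]
        by (fastforce simp: K_def g.supp_def f.supp_def B_def split: if_splits)
      then show ?thesis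
        using nn g.ST_poly_P g.Delta_P g.New_face K
        unfolding K_hull circuit_poly_def G_def by auto
    qed
    obtain e where e: "bij_betw e {..<card ?D} ?D"
      using ex_bij_betw_nat_finite[OF f.finite_D] by (auto simp: atLeast0LessThan)
    have N: "?N = card ?D"
      using False f.finite_D by (simp add: max_def Suc_le_eq card_gt_0_iff)
    have "f - Poly_Mapping.single 0 r = (\<Sum>\<alpha>\<in>?D. G \<alpha>)"
      unfolding split G_def using sum_simplex_polynomials[OF bB] by simp
    also have "\<dots> = (\<Sum>i<?N. G (e i))"
      unfolding N by (rule sum.reindex_bij_betw[OF e, symmetric])
    finally show ?thesis
      using G bij_betwE[OF e] unfolding N by (intro exI[of _ "\<lambda>i. G (e i)"]) auto
  qed
qed

end
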